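(* Let $C$ be a fixed co-wedge in $\mathbb{R}^2$. Let $S$ be a set of $n$ points in $\mathbb{R}^2$ whose pairwise distances are distinct. Then $|\varPhi(S,\mathcal{L}_C)| = O(n)$, where the constant hidden in $O(\cdot)$ depends only on $C$.
   Context: A co-wedge is a (closed) range in $\mathbb{R}^2$ defined by an angle $\theta\in(\pi,2\pi)$, i.e. the union of two halfplanes, whose boundary consists of two rays sharing a common initial point. For $p\in\mathbb{R}^2$, $C_p=p+C$ and $\mathcal{L}_C=\{C_p: p\in\mathbb{R}^2\}$. For a finite set $S$ of points and a collection $\mathcal{X}$ of ranges, a candidate pair in $S$ with respect to $\mathcal{X}$ is an (unordered) pair of distinct points of $S$ that is the closest-pair (the pair of minimum Euclidean distance) in $S\cap X$ for some $X\in\mathcal{X}$; $\varPhi(S,\mathcal{X})$ denotes the set of all candidate pairs. *)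

theory Defs
  imports "HOL-Analysis.Analysis"
begin

(* The closed region swept out by the rays from apex whose directions range over
   [phi, phi + theta].  The polar angle is not reduced modulo 2 * pi. *)
definition angular_region :: "real^2 \<Rightarrow> real \<Rightarrow> real \<Rightarrow> (real^2) set" where
  "angular_region apex phi theta =
     {apex + r *\<^sub>R vector [cos t, sin t] | r t. 0 \<le> r \<and> phi \<le> t \<and> t \<le> phi + theta}"

definition is_cowedge :: "(real^2) set \<Rightarrow> bool" where
  "is_cowedge C \<longleftrightarrow>
     (\<exists>apex phi theta. pi < theta \<and> theta < 2 * pi \<and> C = angular_region apex phi theta)"

definition translates :: "(real^2) set \<Rightarrow> (real^2) set set" where
  "translates C = {(\<lambda>x. p + x) ` C | p. True}"

(* Only minimality is required; the minimizing pair is unique when pairwise distances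
   are distinct. *)
definition is_closest_pair :: "real^2 \<Rightarrow> real^2 \<Rightarrow> (real^2) set \<Rightarrow> bool" where
  "is_closest_pair a b T \<longleftrightarrow>
     a \<in> T \<and> b \<in> T \<and> a \<noteq> b \<and> (\<forall>c\<in>T. \<forall>d\<in>T. c \<noteq> d \<longrightarrow> dist a b \<le> dist c d)"

(* Unordered pairs are represented as two-element sets. *)
definition candidate_pairs :: "(real^2) set \<Rightarrow> (real^2) set set \<Rightarrow> (real^2) set set" where
  "candidate_pairs S \<X> = {{a, b} | a b. \<exists>X\<in>\<X>. is_closest_pair a b (S \<inter> X)}"

definition distinct_distances :: "(real^2) set \<Rightarrow> bool" where
  "distinct_distances S \<longleftrightarrow>
     (\<forall>a\<in>S. \<forall>b\<in>S. \<forall>c\<in>S. \<forall>d\<in>S.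
        a \<noteq> b \<longrightarrow> c \<noteq> d \<longrightarrow> dist a b = dist c d \<longrightarrow> {a, b} = {c, d})"

end

theory Submission
  imports Defs
begin

text \<open>
  Every translate of a co-wedge has the form \<open>{x. s \<le> f x \<or> t \<le> g x}\<close> for two fixed linear
  functionals. A candidate pair lying in one of the two halfplanes is determined by its endpoint
  closest to the boundary. Any other candidate pair has endpoints \<open>a\<close>, \<open>b\<close> with \<open>s = f a\<close> and
  \<open>t = g b\<close> without loss of generality; call it a cross pair. Split the directions into finitely
  many cones of angle less than 60 degrees. Each cross pair is the longest one in its cone at \<open>a\<close>
  or the longest one in its cone at \<open>b\<close>, which leaves linearly many: given longer cross pairs
  \<open>(a, b')\<close> and \<open>(a', b)\<close> in the same cones, the range of \<open>(a, b')\<close> contains \<open>a'\<close> and that of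
  \<open>(a', b)\<close> contains \<open>b'\<close>, whence
  \<open>|ab'| \<le> |aa'| < |a'b| \<le> |bb'| < |ab'|\<close>.
\<close>

section \<open>Cones of directions\<close>

text \<open>Unit vectors at distance below 1 enclose less than 60 degrees. Shortening
  \<open>w\<close> along its own direction to the length of \<open>v\<close> costs
  \<open>norm w - norm v\<close>; from there to \<open>v\<close> the distance is less than
  \<open>norm v\<close>.\<close>

lemma norm_diff_less_of_close_directions:
  fixes v w :: "'a::real_normed_vector"
  assumes "v \<noteq> 0" "norm v \<le> norm w" "dist (sgn v) (sgn w) < 1"
  shows "norm (w - v) < norm w"
proof -
  have w: "w \<noteq> 0" using assms by auto
  have "w - v = norm v *\<^sub>R (sgn w - sgn v) + (norm w - norm v) *\<^sub>R sgn w"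
    using assms(1) w by (simp add: sgn_div_norm algebra_simps)
  then have "norm (w - v) \<le> norm v * norm (sgn w - sgn v) + (norm w - norm v) * norm (sgn w)"
    using norm_triangle_ineq[of "norm v *\<^sub>R (sgn w - sgn v)" "(norm w - norm v) *\<^sub>R sgn w"] assms(2)
    by simp
  also have "\<dots> = norm v * dist (sgn v) (sgn w) + (norm w - norm v)"
    using w by (simp add: norm_sgn dist_norm norm_minus_commute)
  also have "\<dots> < norm v * 1 + (norm w - norm v)"
    using assms by (intro add_strict_right_mono mult_strict_left_mono) auto
  finally show ?thesis by simp
qed

text \<open>Finitely many balls of radius 1/2 cover the unit sphere, and \<open>\<kappa>\<close>
  picks the centre of a ball containing the direction. Directions with a common centre are at
  distance below 1.\<close>

lemma finite_cone_partition:
  obtains F :: "('a::euclidean_space) set" and \<kappa> :: "'a \<Rightarrow> 'a" where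
    "finite F"
    "\<And>v. v \<noteq> 0 \<Longrightarrow> \<kappa> v \<in> F"
    "\<And>v w. v \<noteq> 0 \<Longrightarrow> \<kappa> v = \<kappa> w \<Longrightarrow> norm v \<le> norm w \<Longrightarrow> norm (w - v) < norm w"
proof -
  have "compact (sphere (0::'a) 1)" by simp
  then obtain F :: "'a set" where F: "finite F" "sphere 0 1 \<subseteq> (\<Union>x\<in>F. ball x (1/2))"
    unfolding compact_eq_totally_bounded
    by (metis zero_less_divide_1_iff zero_less_numeral)
  have "\<exists>c\<in>F. dist c (sgn v) < 1/2" if "v \<noteq> 0" for v :: 'a
  proof -
    have "sgn v \<in> sphere 0 1" using that by (simp add: norm_sgn)
    then obtain c where "c \<in> F" "sgn v \<in> ball c (1/2)" using F(2) by blast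
    then show ?thesis by (auto simp: mem_ball)
  qed
  then obtain \<kappa> where \<kappa>: "\<And>v. v \<noteq> 0 \<Longrightarrow> \<kappa> v \<in> F \<and> dist (\<kappa> v) (sgn v) < 1/2"
    by metis
  have "norm (w - v) < norm w" if "v \<noteq> 0" "\<kappa> v = \<kappa> w" "norm v \<le> norm w" for v w
  proof (rule norm_diff_less_of_close_directions)
    have "w \<noteq> 0" using that by auto
    then show "dist (sgn v) (sgn w) < 1"
      using \<kappa>[of v] \<kappa>[of w] that dist_triangle_half_r[of "\<kappa> v" "sgn v" 1 "sgn w"] by auto
  qed (use that in auto)
  then show thesis using that F(1) \<kappa> by blast
qed

section \<open>Closest pairs and candidate pairs of a halfplane\<close>

lemma is_closest_pair_commute: "is_closest_pair a b T \<longleftrightarrow> is_closest_pair b a T"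
  by (auto simp: is_closest_pair_def dist_commute)

lemma is_closest_pair_mono:
  "is_closest_pair a b T \<Longrightarrow> U \<subseteq> T \<Longrightarrow> a \<in> U \<Longrightarrow> b \<in> U \<Longrightarrow> is_closest_pair a b U"
  by (auto simp: is_closest_pair_def)

lemma is_closest_pair_dist_le:
  "is_closest_pair a b T \<Longrightarrow> c \<in> T \<Longrightarrow> d \<in> T \<Longrightarrow> c \<noteq> d \<Longrightarrow> dist a b \<le> dist c d"
  by (auto simp: is_closest_pair_def)

lemma is_closest_pair_unique:
  assumes "distinct_distances S" "is_closest_pair a b (S \<inter> X)" "is_closest_pair c d (S \<inter> X)"
  shows "{a, b} = {c, d}"
proof -
  have "dist a b = dist c d"
    using assms(2,3) unfolding is_closest_pair_def by (metis order_antisym)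
  then show ?thesis
    using assms unfolding distinct_distances_def is_closest_pair_def by (metis IntD1)
qed

text \<open>The threshold sits at the endpoint \<open>a\<close> itself, so that \<open>a\<close>
  alone determines the range.\<close>

definition superlevel_pairs :: "(real^2) set \<Rightarrow> (real^2 \<Rightarrow> real) \<Rightarrow> (real^2) set set" where
  "superlevel_pairs S f = {{a, b} | a b. is_closest_pair a b (S \<inter> {x. f a \<le> f x})}"

lemma card_superlevel_pairs:
  assumes "finite S" "distinct_distances S"
  shows "finite (superlevel_pairs S f)" "card (superlevel_pairs S f) \<le> card S"
proof -
  define h where "h a = {a, SOME b. is_closest_pair a b (S \<inter> {x. f a \<le> f x})}" for a
  have "superlevel_pairs S f \<subseteq> h ` S"
  proof
    fix e assume "e \<in> superlevel_pairs S f"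
    then obtain a b where e: "e = {a, b}" and ab: "is_closest_pair a b (S \<inter> {x. f a \<le> f x})"
      by (auto simp: superlevel_pairs_def)
    have "e = h a"
      unfolding e h_def by (rule is_closest_pair_unique[OF assms(2) ab someI[where x = b]]) (rule ab)
    moreover have "a \<in> S" using ab by (simp add: is_closest_pair_def)
    ultimately show "e \<in> h ` S" by blast
  qed
  then show "finite (superlevel_pairs S f)" "card (superlevel_pairs S f) \<le> card S"
    using assms(1) by (meson finite_imageI finite_subset, meson surj_card_le)
qed

section \<open>Counting cross pairs\<close>

text \<open>The pairs are ordered because the first point sets the level of \<open>f\<close> and the
  second that of \<open>g\<close>.\<close>

definition cross_pairs ::
    "(real^2) set \<Rightarrow> (real^2 \<Rightarrow> real) \<Rightarrow> (real^2 \<Rightarrow> real) \<Rightarrow> ((real^2) \<times> (real^2)) set" where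
  "cross_pairs S f g = {(a, b). is_closest_pair a b (S \<inter> {x. f a \<le> f x \<or> g b \<le> g x})}"

lemma cross_pairsD:
  assumes "(a, b) \<in> cross_pairs S f g"
  shows "a \<in> S" "b \<in> S" "a \<noteq> b"
  using assms by (auto simp: cross_pairs_def is_closest_pair_def)

lemma cross_pairs_swap: "(a, b) \<in> cross_pairs S f g \<longleftrightarrow> (b, a) \<in> cross_pairs S g f"
  by (simp add: cross_pairs_def is_closest_pair_commute[of a b] disj_commute)

lemma cross_pairs_dist_le:
  assumes "(a, b) \<in> cross_pairs S f g" "c \<in> S" "d \<in> S" "c \<noteq> d"
    "f a \<le> f c \<or> g b \<le> g c" "f a \<le> f d \<or> g b \<le> g d"
  shows "dist a b \<le> dist c d"
  using assms by (auto simp: cross_pairs_def intro: is_closest_pair_dist_le)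

text \<open>If \<open>a'\<close> were below \<open>a\<close> in \<open>f\<close>, then the range of
  \<open>(a', b)\<close> would contain the shorter pair \<open>a\<close>, \<open>b\<close>. So
  \<open>a'\<close> lies in the range of \<open>(a, b')\<close>, where \<open>a\<close>,
  \<open>b'\<close> is closest.\<close>

lemma cross_pairs_longer:
  assumes ab: "(a, b) \<in> cross_pairs S f g" and ab': "(a, b') \<in> cross_pairs S f g"
    and a'b: "(a', b) \<in> cross_pairs S f g"
    and longer: "dist a b < dist a b'" "dist a b < dist a' b"
  shows "dist a b' \<le> dist a a'"
proof -
  have "f a \<le> f a'"
    using cross_pairs_dist_le[OF a'b, of a b] cross_pairsD[OF ab] longer by fastforce
  moreover have "a \<noteq> a'" using longer by auto
  ultimately show ?thesis
    using cross_pairs_dist_le[OF ab', of a a'] cross_pairsD[OF ab] cross_pairsD[OF a'b] by auto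
qed

text \<open>Longest is meant per first point and per cone; applied to the converse of
  \<open>E\<close>, the same definition treats the second points.\<close>

definition longest_pairs ::
    "(real^2 \<Rightarrow> real^2) \<Rightarrow> ((real^2) \<times> (real^2)) set \<Rightarrow> ((real^2) \<times> (real^2)) set" where
  "longest_pairs \<kappa> E =
     {(a, b) \<in> E. \<forall>b'. (a, b') \<in> E \<longrightarrow> \<kappa> (b' - a) = \<kappa> (b - a) \<longrightarrow> dist a b' \<le> dist a b}"

text \<open>Two longest pairs from the same point in the same cone have equal length, hence
  coincide. So a pair is determined by its first point and its cone.\<close>

lemma card_longest_pairs:
  assumes "finite S" "distinct_distances S" "finite F"
    and \<kappa>: "\<And>v. v \<noteq> 0 \<Longrightarrow> \<kappa> v \<in> F"
    and E: "\<And>a b. (a, b) \<in> E \<Longrightarrow> a \<in> S \<and> b \<in> S \<and> a \<noteq> b"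
  shows "card (longest_pairs \<kappa> E) \<le> card S * card F"
proof -
  let ?h = "\<lambda>(a, b). (a, \<kappa> (b - a))"
  have "inj_on ?h (longest_pairs \<kappa> E)"
  proof -
    have "b = b'"
      if *: "(a, b) \<in> longest_pairs \<kappa> E" "(a, b') \<in> longest_pairs \<kappa> E"
        "\<kappa> (b - a) = \<kappa> (b' - a)" for a b b'
    proof -
      from * have E2: "(a, b) \<in> E" "(a, b') \<in> E" and "dist a b = dist a b'"
        unfolding longest_pairs_def by (auto intro: order_antisym)
      then have "{a, b} = {a, b'}"
        using assms(2) E[OF E2(1)] E[OF E2(2)] unfolding distinct_distances_def by metis
      then show ?thesis using E[OF E2(1)] by (auto simp: doubleton_eq_iff)
    qed
    then show ?thesis by (auto simp: inj_on_def)
  qed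
  moreover have "?h ` longest_pairs \<kappa> E \<subseteq> S \<times> F"
    using E \<kappa> by (fastforce simp: longest_pairs_def)
  ultimately have "card (longest_pairs \<kappa> E) \<le> card (S \<times> F)"
    using assms by (intro card_inj_on_le) auto
  then show ?thesis by (simp only: card_cartesian_product)
qed

lemma card_cross_pairs:
  obtains K :: nat where
    "\<And>S f g. finite S \<Longrightarrow> distinct_distances S \<Longrightarrow>
       finite (cross_pairs S f g) \<and> card (cross_pairs S f g) \<le> K * card S"
proof -
  obtain F :: "(real^2) set" and \<kappa> :: "real^2 \<Rightarrow> real^2" where F: "finite F" "\<And>v. v \<noteq> 0 \<Longrightarrow> \<kappa> v \<in> F"
    and \<kappa>: "\<And>v w. v \<noteq> 0 \<Longrightarrow> \<kappa> v = \<kappa> w \<Longrightarrow> norm v \<le> norm w \<Longrightarrow> norm (w - v) < norm w"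
    by (fact finite_cone_partition)
  \<comment> \<open>One \<open>card F\<close> for each of the two endpoints; the cones were fixed
    before \<open>S\<close>, \<open>f\<close> and \<open>g\<close>.\<close>
  have "finite (cross_pairs S f g) \<and> card (cross_pairs S f g) \<le> 2 * card F * card S"
    if S: "finite S" "distinct_distances S" for S f g
  proof
    define E where "E = cross_pairs S f g"
    have E: "a \<in> S \<and> b \<in> S \<and> a \<noteq> b" if "(a, b) \<in> E" for a b
      using that cross_pairsD unfolding E_def by metis
    have "E \<subseteq> S \<times> S" using E by auto
    then show fin: "finite (cross_pairs S f g)"
      unfolding E_def[symmetric] using S(1) finite_subset by blast
    have "E \<subseteq> longest_pairs \<kappa> E \<union> (longest_pairs \<kappa> (E\<inverse>))\<inverse>"
    proof (rule ccontr)
      assume "\<not> ?thesis"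
      then obtain a b where ab: "(a, b) \<in> E" and not_longest:
        "(a, b) \<notin> longest_pairs \<kappa> E" "(b, a) \<notin> longest_pairs \<kappa> (E\<inverse>)" by auto
      obtain b' where b': "(a, b') \<in> E" "\<kappa> (b' - a) = \<kappa> (b - a)" "dist a b < dist a b'"
        using not_longest(1) ab unfolding longest_pairs_def by (auto simp: not_le)
      obtain a' where a': "(a', b) \<in> E" "\<kappa> (a' - b) = \<kappa> (a - b)" "dist a b < dist a' b"
        using not_longest(2) ab unfolding longest_pairs_def by (auto simp: not_le dist_commute)
      have "dist a b' \<le> dist a a'"
        using cross_pairs_longer ab b'(1,3) a'(1,3) unfolding E_def by blast
      \<comment> \<open>Seen from \<open>b\<close>, the points \<open>a\<close> and
        \<open>a'\<close> lie in one cone, with \<open>a'\<close> farther away.\<close>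
      also have "dist a a' < dist a' b"
        using \<kappa>[of "a - b" "a' - b"] a' E[OF ab] by (auto simp: dist_norm norm_minus_commute)
      \<comment> \<open>Mirror image of the first inequality, with \<open>f\<close> and
        \<open>g\<close> exchanged.\<close>
      also have "dist a' b \<le> dist b b'"
        using cross_pairs_longer[of b a S g f a' b'] ab b'(1,3) a'(1,3)
        unfolding E_def cross_pairs_swap[of _ _ S f g] by (simp add: dist_commute)
      also have "dist b b' < dist a b'"
        using \<kappa>[of "b - a" "b' - a"] b' E[OF ab] by (auto simp: dist_norm norm_minus_commute)
      finally show False .
    qed
    moreover have "longest_pairs \<kappa> E \<subseteq> E" "(longest_pairs \<kappa> (E\<inverse>))\<inverse> \<subseteq> E"
      unfolding longest_pairs_def by auto
    then have "finite (longest_pairs \<kappa> E)" "finite ((longest_pairs \<kappa> (E\<inverse>))\<inverse>)"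
      using fin unfolding E_def[symmetric] by (metis finite_subset)+
    ultimately have "card E \<le> card (longest_pairs \<kappa> E) + card ((longest_pairs \<kappa> (E\<inverse>))\<inverse>)"
      by (meson card_Un_le card_mono finite_UnI le_trans)
    also have "card ((longest_pairs \<kappa> (E\<inverse>))\<inverse>) = card (longest_pairs \<kappa> (E\<inverse>))"
      by simp
    also have "card (longest_pairs \<kappa> E) + card (longest_pairs \<kappa> (E\<inverse>)) \<le>
        card S * card F + card S * card F"
      using E F by (intro add_mono card_longest_pairs[OF S]) auto
    finally show "card (cross_pairs S f g) \<le> 2 * card F * card S"
      by (simp add: E_def algebra_simps)
  qed
  then show thesis by (rule that)
qed

section \<open>Reduction to halfplane pairs and cross pairs\<close>

text \<open>Raising the thresholds to the levels of the endpoints shrinks the range but keeps both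
  points, so the pair stays closest. The cases record which inequality each endpoint
  satisfies.\<close>

lemma closest_pair_cases:
  assumes "is_closest_pair a b (S \<inter> {x. s \<le> f x \<or> t \<le> g x})"
  shows "{a, b} \<in> superlevel_pairs S f \<union> superlevel_pairs S g \<union>
    (\<lambda>(a, b). {a, b}) ` cross_pairs S f g"
proof -
  have ab: "a \<in> S" "b \<in> S" using assms by (auto simp: is_closest_pair_def)
  \<comment> \<open>The endpoint with the smaller value of \<open>h\<close> becomes the one that
    sets the threshold.\<close>
  have superlevel: "{c, d} \<in> superlevel_pairs S h"
    if cl: "is_closest_pair c d (S \<inter> X)" and X: "\<And>x. r \<le> h x \<Longrightarrow> x \<in> X" "r \<le> h c" "r \<le> h d"
    for c d h X r
  proof -
    have cd: "c \<in> S" "d \<in> S" using cl by (auto simp: is_closest_pair_def)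
    have sub: "S \<inter> {x. h y \<le> h x} \<subseteq> S \<inter> X" if "r \<le> h y" for y
      using X(1) that order_trans by blast
    show ?thesis
    proof (cases "h c \<le> h d")
      case True
      then have "is_closest_pair c d (S \<inter> {x. h c \<le> h x})"
        using cd by (intro is_closest_pair_mono[OF cl sub[OF X(2)]]) auto
      then show ?thesis unfolding superlevel_pairs_def by blast
    next
      case False
      have "is_closest_pair d c (S \<inter> X)" using cl by (simp only: is_closest_pair_commute)
      then have "is_closest_pair d c (S \<inter> {x. h d \<le> h x})"
        using cd False by (intro is_closest_pair_mono[OF _ sub[OF X(3)]]) auto
      then show ?thesis unfolding superlevel_pairs_def insert_commute[of c] by blast
    qed
  qed
  have cross: "{c, d} \<in> (\<lambda>(a, b). {a, b}) ` cross_pairs S f g"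
    if cl: "is_closest_pair c d (S \<inter> {x. s \<le> f x \<or> t \<le> g x})" and "s \<le> f c" "t \<le> g d" for c d
  proof -
    have "c \<in> S" "d \<in> S" using cl by (auto simp: is_closest_pair_def)
    then have "is_closest_pair c d (S \<inter> {x. f c \<le> f x \<or> g d \<le> g x})"
      using that by (intro is_closest_pair_mono[OF cl]) auto
    then show ?thesis unfolding cross_pairs_def by force
  qed
  consider "s \<le> f a" "s \<le> f b" | "t \<le> g a" "t \<le> g b" | "s \<le> f a" "t \<le> g b" | "s \<le> f b" "t \<le> g a"
    using assms by (auto simp: is_closest_pair_def)
  then show ?thesis
  proof cases
    case 1
    then show ?thesis using superlevel[OF assms, of s f] by auto
  next
    case 2
    then show ?thesis using superlevel[OF assms, of t g] by auto
  next
    case 3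
    then show ?thesis using cross[OF assms] by auto
  next
    case 4
    then show ?thesis
      using cross[OF assms[unfolded is_closest_pair_commute[of a]]] by (simp add: insert_commute)
  qed
qed

section \<open>Co-wedges as unions of two halfplanes\<close>

text \<open>The vector is the normal to the ray of angle \<open>psi\<close>, turned
  counterclockwise; the inner product with it is \<open>r * sin (t - psi)\<close>. The converse
  inclusion uses polar coordinates.\<close>

lemma angular_region_pi:
  "angular_region apex psi pi = {x. 0 \<le> (x - apex) \<bullet> vector [- sin psi, cos psi]}"
proof (intro set_eqI iffI)
  fix x assume "x \<in> angular_region apex psi pi"
  then obtain r t where x: "x = apex + r *\<^sub>R vector [cos t, sin t]" and "0 \<le> r" "psi \<le> t" "t \<le> psi + pi"
    unfolding angular_region_def by auto
  have "(x - apex) \<bullet> vector [- sin psi, cos psi] = r * sin (t - psi)"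
    by (simp add: x inner_vec_def sum_2 sin_diff algebra_simps)
  moreover have "0 \<le> sin (t - psi)"
    using \<open>psi \<le> t\<close> \<open>t \<le> psi + pi\<close> by (intro sin_ge_zero) auto
  ultimately show "x \<in> {x. 0 \<le> (x - apex) \<bullet> vector [- sin psi, cos psi]}"
    using \<open>0 \<le> r\<close> by simp
next
  fix x assume "x \<in> {x. 0 \<le> (x - apex) \<bullet> vector [- sin psi, cos psi]}"
  then have nonneg: "0 \<le> (x - apex) \<bullet> vector [- sin psi, cos psi]" by simp
  define w where "w = x - apex"
  \<comment> \<open>\<open>X\<close> and \<open>Y\<close> are the coordinates of \<open>w\<close> in
    the frame rotated by \<open>psi\<close>.\<close>
  define X where "X = w$1 * cos psi + w$2 * sin psi"
  define Y where "Y = w$2 * cos psi - w$1 * sin psi"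
  define r where "r = sqrt (X\<^sup>2 + Y\<^sup>2)"
  have Y: "0 \<le> Y" using nonneg by (simp add: Y_def w_def inner_vec_def sum_2 algebra_simps)
  have w1: "w$1 = X * cos psi - Y * sin psi"
  proof -
    have "X * cos psi - Y * sin psi = w$1 * ((sin psi)\<^sup>2 + (cos psi)\<^sup>2)"
      unfolding X_def Y_def by algebra
    then show ?thesis by simp
  qed
  have w2: "w$2 = X * sin psi + Y * cos psi"
  proof -
    have "X * sin psi + Y * cos psi = w$2 * ((sin psi)\<^sup>2 + (cos psi)\<^sup>2)"
      unfolding X_def Y_def by algebra
    then show ?thesis by simp
  qed
  \<comment> \<open>Since \<open>0 \<le> Y\<close>, the polar angle can be taken as
    \<open>arccos (X / r)\<close>, whose sine is nonnegative; at the apex any angle works, and 0 is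
    chosen.\<close>
  obtain tau where tau: "0 \<le> tau" "tau \<le> pi" "X = r * cos tau" "Y = r * sin tau"
  proof (cases "r = 0")
    case True
    then have "X = 0" "Y = 0" by (auto simp: r_def sum_power2_eq_zero_iff)
    then show thesis using that[of 0] True by simp
  next
    case False
    then have r: "0 < r" unfolding r_def by (metis less_eq_real_def real_sqrt_ge_zero sum_power2_ge_zero)
    have r2: "X\<^sup>2 + Y\<^sup>2 = r\<^sup>2" unfolding r_def by simp
    then have sq: "(X / r)\<^sup>2 + (Y / r)\<^sup>2 = 1"
      using r by (simp add: power_divide flip: add_divide_distrib)
    then have "(X / r)\<^sup>2 \<le> 1" by (metis le_add_same_cancel1 zero_le_power2)
    then have X1: "\<bar>X / r\<bar> \<le> 1" by (simp add: abs_square_le_1)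
    have "sin (arccos (X / r)) = sqrt (1 - (X / r)\<^sup>2)" using X1 by (intro sin_arccos_abs)
    also have "1 - (X / r)\<^sup>2 = (Y / r)\<^sup>2" using sq by linarith
    also have "sqrt ((Y / r)\<^sup>2) = Y / r" using Y r by simp
    finally have "Y = r * sin (arccos (X / r))" using r by simp
    moreover have "X = r * cos (arccos (X / r))" using r cos_arccos_abs[OF X1] by simp
    moreover have "0 \<le> arccos (X / r)" "arccos (X / r) \<le> pi"
      using X1 unfolding abs_le_iff by (auto intro!: arccos_lbound arccos_ubound)
    ultimately show thesis by (intro that)
  qed
  have "x = apex + r *\<^sub>R vector [cos (psi + tau), sin (psi + tau)]"
  proof -
    have "w = r *\<^sub>R vector [cos (psi + tau), sin (psi + tau)]"
      by (simp add: vec_eq_iff forall_2 w1 w2 tau cos_add sin_add algebra_simps)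
    then show ?thesis by (simp add: w_def algebra_simps)
  qed
  moreover have "0 \<le> r" by (simp add: r_def)
  ultimately show "x \<in> angular_region apex psi pi"
    using tau unfolding angular_region_def by force
qed

lemma cowedge_eq_halfplanes:
  assumes "is_cowedge C"
  obtains apex u v where "C = {x. 0 \<le> (x - apex) \<bullet> u \<or> 0 \<le> (x - apex) \<bullet> v}"
proof -
  obtain apex phi theta where theta: "pi < theta" "theta < 2 * pi"
    and C: "C = angular_region apex phi theta"
    using assms unfolding is_cowedge_def by blast
  \<comment> \<open>The two arcs of length \<open>pi\<close> at the ends of the angular range stay
    inside it because \<open>pi < theta\<close> and cover it because
    \<open>theta < 2 * pi\<close>.\<close>
  have "phi \<le> t \<and> t \<le> phi + theta \<longleftrightarrow>
      phi \<le> t \<and> t \<le> phi + pi \<or> phi + theta - pi \<le> t \<and> t \<le> phi + theta - pi + pi" for t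
    using theta by auto
  then have "C = angular_region apex phi pi \<union> angular_region apex (phi + theta - pi) pi"
    unfolding C angular_region_def by blast
  then show thesis using that unfolding angular_region_pi by blast
qed

theorem lemma2p15:
  fixes C :: "(real^2) set"
  assumes "is_cowedge C"
  shows "\<exists>K::real. \<forall>S. finite S \<longrightarrow> distinct_distances S \<longrightarrow>
           real (card (candidate_pairs S (translates C))) \<le> K * real (card S)"
proof -
  obtain apex u v where C: "C = {x. 0 \<le> (x - apex) \<bullet> u \<or> 0 \<le> (x - apex) \<bullet> v}"
    using cowedge_eq_halfplanes[OF assms] .
  define f g where "f x = x \<bullet> u" and "g x = x \<bullet> v" for x :: "real^2"
  obtain K :: nat where K: "\<And>S f g. finite S \<Longrightarrow> distinct_distances S \<Longrightarrow>
      finite (cross_pairs S f g) \<and> card (cross_pairs S f g) \<le> K * card S"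
    by (fact card_cross_pairs)
  \<comment> \<open>Translation leaves the functionals alone and only moves the two
    thresholds.\<close>
  have translate: "(\<lambda>x. p + x) ` C = {x. f (p + apex) \<le> f x \<or> g (p + apex) \<le> g x}" for p
  proof -
    have "x \<in> (\<lambda>x. p + x) ` C \<longleftrightarrow> x - p \<in> C" for x
      by (auto intro: image_eqI[where x = "x - p"])
    then show ?thesis by (auto simp: C f_def g_def algebra_simps)
  qed
  \<comment> \<open>The 2 accounts for the two halfplane families, \<open>K\<close> for the cross
    pairs.\<close>
  have "real (card (candidate_pairs S (translates C))) \<le> real (K + 2) * real (card S)"
    if S: "finite S" "distinct_distances S" for S
  proof -
    let ?X = "(\<lambda>(a, b). {a, b}) ` cross_pairs S f g"
    have "candidate_pairs S (translates C) \<subseteq> superlevel_pairs S f \<union> superlevel_pairs S g \<union> ?X"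
    proof
      fix e assume "e \<in> candidate_pairs S (translates C)"
      then obtain a b p where "e = {a, b}" "is_closest_pair a b (S \<inter> (\<lambda>x. p + x) ` C)"
        unfolding candidate_pairs_def translates_def by blast
      then show "e \<in> superlevel_pairs S f \<union> superlevel_pairs S g \<union> ?X"
        unfolding translate using closest_pair_cases by blast
    qed
    then have "card (candidate_pairs S (translates C)) \<le>
        card (superlevel_pairs S f \<union> superlevel_pairs S g \<union> ?X)"
      using card_superlevel_pairs(1)[OF S] K[OF S] by (intro card_mono) auto
    also have "\<dots> \<le> card (superlevel_pairs S f) + card (superlevel_pairs S g) + card ?X"
      by (intro order_trans[OF card_Un_le] add_mono card_Un_le order_refl)
    also have "\<dots> \<le> card S + card S + K * card S"
      using card_superlevel_pairs(2)[OF S] K[OF S]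
      by (intro add_mono) (auto intro: order_trans[OF card_image_le])
    also have "\<dots> = (K + 2) * card S" by simp
    finally show ?thesis by (metis of_nat_le_iff of_nat_mult)
  qed
  then show ?thesis by blast
qed

end
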